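(* Let $n\ge 2$ and let $\pi$ be an $R$-representation of $G=\mathrm{GL}_n(\mathbf{k})$ such that $\pi^\vee$ is cuspidal and satisfies Schur's lemma. Then $\pi$ satisfies the strong Godement--Jacquet functional equation $\mathbf{GJFE}$: for every non-trivial spectral character $\psi$ of $\mathbf{k}$ there exists $\gamma(\pi,\psi)\in R$ such that $$\sum_{g\in G}\widehat{\Phi}(g)\,v^\vee(\pi(g^{-1})v)=\gamma(\pi,\psi)\sum_{g\in G}\Phi(g)\,v^\vee(\pi(g)v)$$ for all functions $\Phi:M_n(\mathbf{k})\to R$ and all $(v,v^\vee)\in V\times V^\vee$, where $V$ is the space of $\pi$.
   Context: $\mathbf{k}$ is a finite field of characteristic $p$, $\mu_p\subset\mathbb{C}^\times$ is the group of $p$-th roots of unity, and $R$ is a commutative $\mathbb{Z}[\mu_p]$-algebra such that $\mu_p\to R^\times$ is injective and $R^\times$ contains a square root $|M_n(\mathbf{k})|^{1/2}$ of $|M_n(\mathbf{k})|$, which is fixed. Spectral characters of $\mathbf{k}$ are the characters $\mathbf{k}\to R^\times$ obtained by composing a homomorphism $\mathbf{k}\to\mu_p$ with $\mu_p\to R^\times$. For such a non-trivial $\psi$, $\Psi=\psi\circ\mathrm{tr}$ on $M_n(\mathbf{k})$ and $\widehat\Phi(a)=|M_n(\mathbf{k})|^{-1/2}\sum_{g\in M_n(\mathbf{k})}\Phi(g)\Psi(ga)$. For an $R$-representation $(\pi,V)$ of $G$ (on an $R$-module $V$), $(\pi^\vee,V^\vee)$ is the contragredient, $V^\vee=\mathrm{Hom}_R(V,R)$,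 $(\pi^\vee(g)v^\vee)(v)=v^\vee(\pi(g^{-1})v)$. A representation $(\rho,W)$ of $G$ is cuspidal if the coinvariants $W_U$ vanish for the unipotent radical $U$ of every proper parabolic subgroup of $G$. A representation $(\rho,W)$ satisfies Schur's lemma if the natural map $R\to\mathrm{End}_{R[G]}(W)$, $r\mapsto r\,\mathrm{Id}_W$, is an isomorphism. *)

theory Defs
  imports "HOL-Analysis.Analysis" "HOL-Library.Function_Algebras"
begin

section \<open>The coefficient ring\<close>

definition root_group :: "nat \<Rightarrow> complex set" where
  "root_group p = {z. z ^ p = 1}"

definition unital_subring :: "complex set \<Rightarrow> bool" where
  "unital_subring S \<longleftrightarrow> 1 \<in> S \<and> (\<forall>x\<in>S. \<forall>y\<in>S. x - y \<in> S \<and> x * y \<in> S)"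

text \<open>\<open>cyclotomic_ring p\<close> is the subring of the complex numbers generated by the p-th roots
  of unity.\<close>

definition cyclotomic_ring :: "nat \<Rightarrow> complex set" where
  "cyclotomic_ring p = unital_subring hull root_group p"

text \<open>An algebra structure over \<open>cyclotomic_ring p\<close> on a commutative ring is given by its
  structure map, of which only the values on \<open>cyclotomic_ring p\<close> matter.\<close>

definition cyclotomic_algebra :: "nat \<Rightarrow> (complex \<Rightarrow> 'r::comm_ring_1) \<Rightarrow> bool" where
  "cyclotomic_algebra p \<iota> \<longleftrightarrow> \<iota> 1 = 1 \<and>
     (\<forall>x\<in>cyclotomic_ring p. \<forall>y\<in>cyclotomic_ring p.
        \<iota> (x + y) = \<iota> x + \<iota> y \<and> \<iota> (x * y) = \<iota> x * \<iota> y)"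

text \<open>Meaningful only when \<open>s\<close> is a unit, in which case the inverse is unique.\<close>

definition unit_inverse :: "'r::comm_ring_1 \<Rightarrow> 'r" where
  "unit_inverse s = (THE t. s * t = 1)"

definition spectral_character :: "(complex \<Rightarrow> 'r::comm_ring_1) \<Rightarrow> ('k::field \<Rightarrow> 'r) \<Rightarrow> bool" where
  "spectral_character \<iota> \<psi> \<longleftrightarrow>
     (\<exists>\<theta>. range \<theta> \<subseteq> root_group CHAR('k) \<and> (\<forall>x y. \<theta> (x + y) = \<theta> x * \<theta> y) \<and> \<psi> = \<iota> \<circ> \<theta>)"

text \<open>The parameter \<open>s\<close> is the fixed square root of the number of matrices.\<close>

definition matrix_fourier ::
  "'r::comm_ring_1 \<Rightarrow> ('k::{field,finite} \<Rightarrow> 'r) \<Rightarrow> ('k^'n^'n \<Rightarrow> 'r) \<Rightarrow> 'k^'n^'n \<Rightarrow> 'r" where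
  "matrix_fourier s \<psi> \<Phi> a = unit_inverse s * (\<Sum>g\<in>UNIV. \<Phi> g * \<psi> (trace (g ** a)))"


section \<open>The general linear group, parabolic subgroups and unipotent radicals\<close>

definition GL :: "('k::field^'n^'n) set" where
  "GL = {g. invertible g}"

definition flag :: "('k::field^'n) set list \<Rightarrow> bool" where
  "flag F \<longleftrightarrow> F \<noteq> [] \<and> hd F = {0} \<and> last F = UNIV \<and> sorted_wrt (\<subset>) F \<and>
     (\<forall>S\<in>set F. vec.subspace S)"

text \<open>The parabolic subgroups of the general linear group are the stabilizers of flags. The
  unipotent radical consists of the elements acting trivially on the successive quotients of
  the flag.\<close>

definition parabolic :: "('k::field^'n) set list \<Rightarrow> ('k^'n^'n) set" where
  "parabolic F = {g \<in> GL. \<forall>S\<in>set F. (*v) g ` S = S}"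

definition unipotent_radical :: "('k::field^'n) set list \<Rightarrow> ('k^'n^'n) set" where
  "unipotent_radical F =
     {g \<in> parabolic F. \<forall>i. Suc i < length F \<longrightarrow> (\<forall>x \<in> F ! Suc i. g *v x - x \<in> F ! i)}"


section \<open>Representations of the general linear group\<close>

text \<open>The space of a representation is a submodule \<open>W\<close> of an ambient module; the ambient module
  is only there because the dual module is a set of functions and not a type. Only the values of
  a representation on invertible matrices and on vectors in \<open>W\<close> matter.\<close>

definition linear_endo :: "('r::comm_ring_1 \<Rightarrow> 'w::ab_group_add \<Rightarrow> 'w) \<Rightarrow> 'w set \<Rightarrow> ('w \<Rightarrow> 'w) \<Rightarrow> bool" where
  "linear_endo scl W f \<longleftrightarrow> f \<in> W \<rightarrow> W \<and> (\<forall>x\<in>W. \<forall>y\<in>W. f (x + y) = f x + f y) \<and>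
     (\<forall>r. \<forall>x\<in>W. f (scl r x) = scl r (f x))"

definition GL_representation ::
  "('r::comm_ring_1 \<Rightarrow> 'w::ab_group_add \<Rightarrow> 'w) \<Rightarrow> 'w set \<Rightarrow> ('k::field^'n^'n \<Rightarrow> 'w \<Rightarrow> 'w) \<Rightarrow> bool" where
  "GL_representation scl W \<rho> \<longleftrightarrow> module scl \<and> module.subspace scl W \<and>
     (\<forall>g\<in>GL. linear_endo scl W (\<rho> g)) \<and>
     (\<forall>w\<in>W. \<rho> (mat 1) w = w) \<and>
     (\<forall>g\<in>GL. \<forall>h\<in>GL. \<forall>w\<in>W. \<rho> (g ** h) w = \<rho> g (\<rho> h w))"

definition coinvariant_kernel ::
  "('r::comm_ring_1 \<Rightarrow> 'w::ab_group_add \<Rightarrow> 'w) \<Rightarrow> 'w set \<Rightarrow> ('g \<Rightarrow> 'w \<Rightarrow> 'w) \<Rightarrow> 'g set \<Rightarrow> 'w set" where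
  "coinvariant_kernel scl W \<rho> U = module.span scl {\<rho> u w - w | u w. u \<in> U \<and> w \<in> W}"

definition coinvariants ::
  "('r::comm_ring_1 \<Rightarrow> 'w::ab_group_add \<Rightarrow> 'w) \<Rightarrow> 'w set \<Rightarrow> ('g \<Rightarrow> 'w \<Rightarrow> 'w) \<Rightarrow> 'g set \<Rightarrow> 'w set set" where
  "coinvariants scl W \<rho> U =
     W // {(x, y). x \<in> W \<and> y \<in> W \<and> x - y \<in> coinvariant_kernel scl W \<rho> U}"

text \<open>The kernel is the zero element of the quotient module, so the coinvariants vanish if and
  only if the kernel is the only class.\<close>

definition cuspidal ::
  "('r::comm_ring_1 \<Rightarrow> 'w::ab_group_add \<Rightarrow> 'w) \<Rightarrow> 'w set \<Rightarrow> ('k::field^'n^'n \<Rightarrow> 'w \<Rightarrow> 'w) \<Rightarrow> bool" where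
  "cuspidal scl W \<rho> \<longleftrightarrow>
     (\<forall>F. flag F \<and> parabolic F \<noteq> (GL :: ('k^'n^'n) set) \<longrightarrow>
        coinvariants scl W \<rho> (unipotent_radical F) =
          {coinvariant_kernel scl W \<rho> (unipotent_radical F)})"

definition GL_endos ::
  "('r::comm_ring_1 \<Rightarrow> 'w::ab_group_add \<Rightarrow> 'w) \<Rightarrow> 'w set \<Rightarrow> ('k::field^'n^'n \<Rightarrow> 'w \<Rightarrow> 'w) \<Rightarrow> ('w \<Rightarrow> 'w) set" where
  "GL_endos scl W \<rho> =
     {f \<in> extensional W. linear_endo scl W f \<and> (\<forall>g\<in>GL. \<forall>w\<in>W. f (\<rho> g w) = \<rho> g (f w))}"

text \<open>The natural map is always a ring homomorphism, so it is an isomorphism if and only if it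
  is bijective.\<close>

definition satisfies_schur ::
  "('r::comm_ring_1 \<Rightarrow> 'w::ab_group_add \<Rightarrow> 'w) \<Rightarrow> 'w set \<Rightarrow> ('k::field^'n^'n \<Rightarrow> 'w \<Rightarrow> 'w) \<Rightarrow> bool" where
  "satisfies_schur scl W \<rho> \<longleftrightarrow>
     bij_betw (\<lambda>r. restrict (scl r) W) UNIV (GL_endos scl W \<rho>)"


section \<open>The contragredient\<close>

definition dual_space :: "('r::comm_ring_1 \<Rightarrow> 'v::ab_group_add \<Rightarrow> 'v) \<Rightarrow> ('v \<Rightarrow> 'r) set" where
  "dual_space scl = {f. module_hom scl (*) f}"

definition dual_scale :: "'r::comm_ring_1 \<Rightarrow> ('v \<Rightarrow> 'r) \<Rightarrow> 'v \<Rightarrow> 'r" where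
  "dual_scale r f = (\<lambda>v. r * f v)"

definition contragredient ::
  "('k::field^'n^'n \<Rightarrow> 'v \<Rightarrow> 'v) \<Rightarrow> 'k^'n^'n \<Rightarrow> ('v \<Rightarrow> 'r) \<Rightarrow> 'v \<Rightarrow> 'r" where
  "contragredient \<pi> g f = (\<lambda>v. f (\<pi> (matrix_inv g) v))"

end

theory Submission
  imports Defs
begin

text \<open>With \<open>\<rho> = \<pi>\<^sup>\<or>\<close> and \<open>Z(x) = \<Sum>\<^sub>g \<psi>(tr(xg)) \<rho>(g)\<close>, the left-hand side of the functional
  equation is, up to the normalizing factor, the sum of \<open>\<Phi>(x) (Z(x)v\<^sup>\<or>)(v)\<close> over all matrices \<open>x\<close>.
  If \<open>x\<close> is singular, its image lies in a proper nonzero subspace \<open>S\<close>, and the unipotent radical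
  \<open>U\<close> of the stabilizer of \<open>0 \<subset> S \<subset> k\<^sup>n\<close> satisfies \<open>ux = x\<close>; hence \<open>Z(x)\<close> factors through the
  \<open>U\<close>-coinvariants and vanishes. If \<open>x\<close> is invertible, \<open>Z(x) = \<rho>(x\<^sup>-\<^sup>1) Z(1)\<close>, where \<open>Z(1)\<close> commutes
  with the group and is therefore a scalar by Schur's lemma.\<close>

section \<open>Matrices\<close>

lemma GL_matrix_inv:
  assumes "g \<in> GL"
  shows "g ** matrix_inv g = mat 1" "matrix_inv g ** g = mat 1" "matrix_inv g \<in> GL"
proof -
  have "\<exists>h. g ** h = mat 1 \<and> h ** g = mat 1"
    using assms by (auto simp: GL_def invertible_def)
  from someI_ex[OF this] show "g ** matrix_inv g = mat 1" "matrix_inv g ** g = mat 1"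
    by (simp_all add: matrix_inv_def)
  then show "matrix_inv g \<in> GL"
    by (auto simp: GL_def invertible_def)
qed

lemma mat_1_GL: "mat 1 \<in> GL"
  by (auto simp: GL_def invertible_def intro!: exI[of _ "mat 1"])

lemma GL_mult: "g \<in> GL \<Longrightarrow> h \<in> GL \<Longrightarrow> g ** h \<in> GL"
  by (simp add: GL_def invertible_mult)

lemma matrix_inv_unique:
  assumes "g \<in> GL" "g ** h = mat 1"
  shows "matrix_inv g = h"
  by (metis GL_matrix_inv(2) assms matrix_mul_assoc matrix_mul_lid matrix_mul_rid)

lemma matrix_inv_involution: "g \<in> GL \<Longrightarrow> matrix_inv (matrix_inv g) = g"
  by (rule matrix_inv_unique) (simp_all add: GL_matrix_inv)

lemma matrix_inv_mult:
  assumes "g \<in> GL" "h \<in> GL"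
  shows "matrix_inv (g ** h) = matrix_inv h ** matrix_inv g"
proof (rule matrix_inv_unique)
  have "g ** h ** (matrix_inv h ** matrix_inv g) = g ** (h ** matrix_inv h) ** matrix_inv g"
    by (simp add: matrix_mul_assoc)
  then show "g ** h ** (matrix_inv h ** matrix_inv g) = mat 1"
    by (simp add: GL_matrix_inv assms)
qed (simp add: GL_mult assms)

lemma bij_betw_GL_mult_right:
  assumes "h \<in> GL"
  shows "bij_betw (\<lambda>g. g ** h) GL GL"
  by (rule bij_betw_byWitness[where f' = "\<lambda>g. g ** matrix_inv h"])
    (auto simp: GL_mult GL_matrix_inv assms simp flip: matrix_mul_assoc)

lemma bij_betw_GL_mult_left:
  assumes "h \<in> GL"
  shows "bij_betw (\<lambda>g. h ** g) GL GL"
  by (rule bij_betw_byWitness[where f' = "\<lambda>g. matrix_inv h ** g"])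
    (auto simp: GL_mult GL_matrix_inv assms matrix_mul_assoc)

section \<open>Singular matrices and the unipotent radicals fixing them\<close>

lemma singular_matrix_hyperplane:
  fixes x :: "'k::field^'n^'n"
  assumes "x \<notin> GL"
  obtains c :: "'n \<Rightarrow> 'k" and i where "c i \<noteq> 0" "\<And>v. (\<Sum>i\<in>UNIV. c i * (x *v v) $ i) = 0"
proof -
  have "\<not> (\<exists>B. x ** B = mat 1)"
    using assms by (simp add: GL_def invertible_right_inverse)
  \<comment> \<open>The rows of a singular matrix are dependent; the coefficients \<open>c\<close>
    of a relation form a nonzero linear form vanishing on the image of \<open>x\<close>.\<close>
  then obtain c i where c: "(\<Sum>i\<in>UNIV. c i *s row i x) = 0" "c i \<noteq> 0"
    unfolding matrix_right_invertible_independent_rows by blast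
  have "(\<Sum>i\<in>UNIV. c i * (x *v v) $ i) = 0" for v
  proof -
    have "(\<Sum>i\<in>UNIV. c i * (x *v v) $ i) = (\<Sum>i\<in>UNIV. \<Sum>j\<in>UNIV. c i * x $ i $ j * v $ j)"
      by (simp add: matrix_vector_mult_def sum_distrib_left mult.assoc)
    also have "\<dots> = (\<Sum>j\<in>UNIV. (\<Sum>i\<in>UNIV. c i *s row i x) $ j * v $ j)"
      by (subst sum.swap) (simp add: row_def sum_distrib_right)
    finally show ?thesis
      by (simp add: c)
  qed
  with c(2) show thesis
    by (rule that)
qed

lemma exists_other_index:
  assumes "CARD('n::finite) \<ge> 2"
  shows "\<exists>j. j \<noteq> (i :: 'n)"
proof (rule ccontr)
  assume "\<not> ?thesis"
  then have "UNIV = {i}"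
    by blast
  then have "CARD('n) = card {i}"
    by (rule arg_cong)
  with assms show False
    by simp
qed

text \<open>The image of \<open>x\<close> would not do for \<open>S\<close>, being zero when
  \<open>x = 0\<close>. The kernel of the linear form is a hyperplane containing the image, and it
  is nonzero because the dimension is at least 2.\<close>

lemma singular_matrix_proper_subspace:
  fixes x :: "'k::field^'n^'n"
  assumes "x \<notin> GL" "CARD('n) \<ge> 2"
  obtains S where "vec.subspace S" "{0} \<subset> S" "S \<subset> UNIV" "\<And>v. x *v v \<in> S"
proof -
  obtain c i where ci: "c i \<noteq> 0" and x: "\<And>v. (\<Sum>i\<in>UNIV. c i * (x *v v) $ i) = 0"
    using singular_matrix_hyperplane[OF assms(1)] by metis
  obtain j where j: "j \<noteq> i"
    using assms(2) exists_other_index by metis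
  have axis: "(\<Sum>m\<in>UNIV. c m * axis l a $ m) = c l * a" for l a
    by (simp add: axis_def if_distrib[of "\<lambda>x. _ * x"] cong: if_cong)
  define S where "S = {v :: 'k^'n. (\<Sum>i\<in>UNIV. c i * v $ i) = 0}"
  have "vec.subspace S"
    by (auto simp: S_def vec.subspace_def algebra_simps sum.distrib simp flip: sum_distrib_left)
  \<comment> \<open>The form takes the value \<open>c i * c j - c j * c i\<close> here, while
    coordinate \<open>j\<close> is \<open>- c i\<close>, which is nonzero.\<close>
  moreover have "axis i (c j) - axis j (c i) \<in> S"
    by (simp add: S_def right_diff_distrib sum_subtractf axis)
  moreover have "axis i (c j) - axis j (c i) \<noteq> 0"
  proof
    assume "axis i (c j) - axis j (c i) = 0"
    then have "(axis i (c j) - axis j (c i)) $ j = 0"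
      by simp
    then show False
      using ci j by (simp add: axis_def)
  qed
  moreover have "axis i 1 \<notin> S"
    using ci by (simp add: S_def axis)
  moreover have "x *v v \<in> S" for v
    by (simp add: S_def x)
  ultimately show thesis
    using that[of S] vec.subspace_0[of S] by blast
qed

lemma transvection:
  fixes i j :: "'n::finite" and c :: "'k::field"
  assumes "i \<noteq> j"
  obtains g :: "'k^'n^'n" where "g \<in> GL" "\<And>v. g *v v = v + axis j (c * v $ i)"
proof -
  define t where "t c = (\<chi> a b. (if a = b then 1 else 0) + (if a = j \<and> b = i then c else 0))" for c :: 'k
  have t: "t c *v v = v + axis j (c * v $ i)" for c v
    by (auto simp: t_def vec_eq_iff matrix_vector_mult_def axis_def distrib_right sum.distrib
        if_distrib[of "\<lambda>x. x * _"] cong: if_cong)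
  \<comment> \<open>Since \<open>i\<close> and \<open>j\<close> differ, adding a multiple of
    \<open>axis j 1\<close> leaves coordinate \<open>i\<close> alone, so parameters add.\<close>
  have "t c ** t (- c) = mat 1"
    by (simp add: matrix_eq t axis_def vec_eq_iff assms flip: matrix_vector_mul_assoc)
  then have "t c \<in> GL"
    unfolding GL_def mem_Collect_eq invertible_right_inverse by blast
  then show thesis
    using t by (rule that)
qed

text \<open>Cuspidality speaks only of proper parabolics, so the stabilizer of \<open>S\<close> must
  be shown proper. Otherwise transvections would produce every standard basis vector from one
  nonzero vector of \<open>S\<close>.\<close>

lemma proper_subspace_not_GL_invariant:
  fixes S :: "('k::field^'n) set"
  assumes S: "vec.subspace S" "{0} \<subset> S" "S \<subset> UNIV" and n: "CARD('n) \<ge> 2"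
  shows "\<exists>g\<in>GL. (*v) g ` S \<noteq> S"
proof (rule ccontr)
  assume "\<not> ?thesis"
  then have inv: "g *v v \<in> S" if "g \<in> GL" "v \<in> S" for g v
    using that by blast
  have step: "axis j 1 \<in> S" if "v \<in> S" "v $ i \<noteq> 0" "i \<noteq> j" for v i j
  proof -
    obtain g :: "'k^'n^'n" where g: "g \<in> GL" "\<And>w. g *v w = w + axis j (inverse (v $ i) * w $ i)"
      using transvection[OF \<open>i \<noteq> j\<close>] by metis
    have "g *v v - v \<in> S"
      by (intro vec.subspace_diff S inv g that)
    then show ?thesis
      using that by (simp add: g)
  qed
  obtain w where "w \<in> S" "w \<noteq> 0"
    using S by blast
  then obtain i where w: "w \<in> S" "w $ i \<noteq> 0"
    by (auto simp: vec_eq_iff)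
  obtain j where j: "i \<noteq> j"
    using n exists_other_index by metis
  \<comment> \<open>A transvection reaches only indices other than \<open>i\<close>; the index
    \<open>i\<close> itself is reached by a detour through \<open>j\<close>.\<close>
  have "axis i 1 \<in> S"
    using step[of "axis j 1" j i] step[OF w j] j by simp
  then have "axis l 1 \<in> S" for l
    using step[OF w, of l] by (cases "l = i") auto
  then have "v \<in> S" for v :: "'k^'n"
    by (subst basis_expansion[symmetric]) (intro vec.subspace_sum vec.subspace_scale S)
  with S show False
    by blast
qed

lemma singular_matrix_unipotent_radical:
  fixes x :: "'k::field^'n^'n"
  assumes "x \<notin> GL" "CARD('n) \<ge> 2"
  obtains F :: "('k^'n) set list" where "flag F" "parabolic F \<noteq> GL"
    "\<And>u. u \<in> unipotent_radical F \<Longrightarrow> u ** x = x"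
proof -
  obtain S where S: "vec.subspace S" "{0} \<subset> S" "S \<subset> UNIV" and x: "\<And>v. x *v v \<in> S"
    using singular_matrix_proper_subspace[OF assms] by metis
  define F where "F = [{0}, S, UNIV]"
  have "flag F"
    using S by (auto simp: flag_def F_def vec.subspace_def)
  moreover have "parabolic F \<noteq> GL"
    using proper_subspace_not_GL_invariant[OF S assms(2)] by (auto simp: parabolic_def F_def)
  moreover have "u ** x = x" if "u \<in> unipotent_radical F" for u
  proof -
    \<comment> \<open>This is the condition at position 0 of the flag: \<open>u *v w - w\<close>
      lies in \<open>{0}\<close>.\<close>
    have "u *v w = w" if "w \<in> S" for w
      using \<open>u \<in> unipotent_radical F\<close> that by (force simp: unipotent_radical_def F_def)
    then show ?thesis
      by (simp add: matrix_eq x flip: matrix_vector_mul_assoc)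
  qed
  ultimately show thesis
    by (rule that)
qed

section \<open>Gauss sums with values in a representation\<close>

text \<open>The operator \<open>Z(x)\<close> of the overview. Only \<open>g\<close> is restricted to
  \<open>GL\<close>; the argument \<open>x\<close> may be singular. For an additive character
  \<open>\<psi>\<close> and \<open>x = mat 1\<close> this is the non-abelian Gauss sum of the
  representation.\<close>

definition gauss_sum ::
  "('r::comm_ring_1 \<Rightarrow> 'w::ab_group_add \<Rightarrow> 'w) \<Rightarrow> ('k::field^'n^'n \<Rightarrow> 'w \<Rightarrow> 'w) \<Rightarrow> ('k \<Rightarrow> 'r) \<Rightarrow>
     'k^'n^'n \<Rightarrow> 'w \<Rightarrow> 'w" where
  "gauss_sum scl \<rho> \<psi> x w = (\<Sum>g\<in>GL. scl (\<psi> (trace (x ** g))) (\<rho> g w))"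

locale GL_rep =
  fixes scl :: "'r::comm_ring_1 \<Rightarrow> 'w::ab_group_add \<Rightarrow> 'w"
    and W :: "'w set"
    and \<rho> :: "'k::{field,finite}^'n^'n \<Rightarrow> 'w \<Rightarrow> 'w"
  assumes rep: "GL_representation scl W \<rho>"
begin

sublocale module scl
  using rep by (simp add: GL_representation_def)

lemma subspace_W: "subspace W"
  using rep by (simp add: GL_representation_def)

lemma endo: "g \<in> GL \<Longrightarrow> linear_endo scl W (\<rho> g)"
  using rep by (simp add: GL_representation_def)

lemma rho_closed: "g \<in> GL \<Longrightarrow> w \<in> W \<Longrightarrow> \<rho> g w \<in> W"
  using endo by (auto simp: linear_endo_def Pi_iff)

lemma rho_add: "g \<in> GL \<Longrightarrow> v \<in> W \<Longrightarrow> w \<in> W \<Longrightarrow> \<rho> g (v + w) = \<rho> g v + \<rho> g w"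
  using endo by (auto simp: linear_endo_def)

lemma rho_scale: "g \<in> GL \<Longrightarrow> w \<in> W \<Longrightarrow> \<rho> g (scl r w) = scl r (\<rho> g w)"
  using endo by (auto simp: linear_endo_def)

lemma rho_zero: "g \<in> GL \<Longrightarrow> \<rho> g 0 = 0"
  using rho_scale[of g 0 0] subspace_0[OF subspace_W] by simp

lemma rho_mult: "g \<in> GL \<Longrightarrow> h \<in> GL \<Longrightarrow> w \<in> W \<Longrightarrow> \<rho> (g ** h) w = \<rho> g (\<rho> h w)"
  using rep by (simp add: GL_representation_def)

lemma rho_sum:
  assumes "g \<in> GL" "\<And>a. a \<in> A \<Longrightarrow> f a \<in> W"
  shows "\<rho> g (\<Sum>a\<in>A. f a) = (\<Sum>a\<in>A. \<rho> g (f a))"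
  using assms(2)
  by (induction A rule: infinite_finite_induct)
    (simp_all add: rho_zero rho_add subspace_sum[OF subspace_W] assms(1))

lemma gauss_sum_endo: "linear_endo scl W (gauss_sum scl \<rho> \<psi> x)"
  unfolding linear_endo_def gauss_sum_def
  by (auto intro!: subspace_sum subspace_scale subspace_W rho_closed sum.cong
      simp: rho_add rho_scale scale_right_distrib sum.distrib scale_sum_right mult.commute)

text \<open>Substitute \<open>g ** h\<close> for \<open>g\<close>; cyclicity of the trace then
  carries \<open>h\<close> to the left of \<open>x\<close>.\<close>

lemma gauss_sum_rho:
  assumes "h \<in> GL" "w \<in> W"
  shows "gauss_sum scl \<rho> \<psi> (h ** x) (\<rho> h w) = gauss_sum scl \<rho> \<psi> x w"
proof -
  have "gauss_sum scl \<rho> \<psi> x w = (\<Sum>g\<in>GL. scl (\<psi> (trace (x ** (g ** h)))) (\<rho> (g ** h) w))"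
    unfolding gauss_sum_def by (rule sum.reindex_bij_betw[OF bij_betw_GL_mult_right, symmetric]) fact
  also have "\<dots> = (\<Sum>g\<in>GL. scl (\<psi> (trace (h ** x ** g))) (\<rho> g (\<rho> h w)))"
  proof (rule sum.cong)
    show "scl (\<psi> (trace (x ** (g ** h)))) (\<rho> (g ** h) w) = scl (\<psi> (trace (h ** x ** g))) (\<rho> g (\<rho> h w))"
      if "g \<in> GL" for g
      using that assms trace_mul_sym[of "x ** g" h] by (simp add: rho_mult matrix_mul_assoc)
  qed simp
  finally show ?thesis
    by (simp add: gauss_sum_def)
qed

text \<open>The counterpart for the substitution of \<open>h ** g\<close>, where
  \<open>\<rho> h\<close> comes out of the sum by linearity.\<close>

lemma rho_gauss_sum:
  assumes "h \<in> GL" "w \<in> W"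
  shows "\<rho> h (gauss_sum scl \<rho> \<psi> (x ** h) w) = gauss_sum scl \<rho> \<psi> x w"
proof -
  have "gauss_sum scl \<rho> \<psi> x w = (\<Sum>g\<in>GL. scl (\<psi> (trace (x ** (h ** g)))) (\<rho> (h ** g) w))"
    unfolding gauss_sum_def by (rule sum.reindex_bij_betw[OF bij_betw_GL_mult_left, symmetric]) fact
  also have "\<dots> = \<rho> h (gauss_sum scl \<rho> \<psi> (x ** h) w)"
    using assms unfolding gauss_sum_def
    by (simp add: rho_sum rho_scale rho_closed subspace_scale[OF subspace_W] rho_mult matrix_mul_assoc)
  finally show ?thesis ..
qed

text \<open>Vanishing coinvariants identify the class of \<open>w\<close> with the kernel, and
  \<open>w\<close> lies in its own class.\<close>

lemma cuspidal_span:
  assumes "cuspidal scl W \<rho>" "flag F" "parabolic F \<noteq> (GL :: ('k^'n^'n) set)" "w \<in> W"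
  shows "w \<in> span {\<rho> u w - w | u w. u \<in> unipotent_radical F \<and> w \<in> W}"
proof -
  let ?N = "coinvariant_kernel scl W \<rho> (unipotent_radical F)"
  let ?C = "{(x, y). x \<in> W \<and> y \<in> W \<and> x - y \<in> ?N} `` {w}"
  have "?C \<in> coinvariants scl W \<rho> (unipotent_radical F)"
    unfolding coinvariants_def by (intro quotientI assms)
  then have "?C = ?N"
    using assms by (auto simp: cuspidal_def)
  moreover have "w \<in> ?C"
    using assms(4) by (simp add: coinvariant_kernel_def span_zero)
  ultimately show ?thesis
    by (simp add: coinvariant_kernel_def)
qed

text \<open>For \<open>u ** x = x\<close>, \<open>gauss_sum_rho\<close> shows that
  \<open>Z(x)\<close> takes the same value at \<open>\<rho> u w\<close> and \<open>w\<close>. So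
  \<open>Z(x)\<close> kills the generators of the coinvariant kernel, which by cuspidality is all of
  \<open>W\<close>.\<close>

lemma gauss_sum_singular:
  assumes "cuspidal scl W \<rho>" "CARD('n) \<ge> 2" "x \<notin> GL" "w \<in> W"
  shows "gauss_sum scl \<rho> \<psi> x w = 0"
proof -
  let ?Z = "gauss_sum scl \<rho> \<psi> x"
  obtain F :: "('k^'n) set list" where F: "flag F" "parabolic F \<noteq> (GL :: ('k^'n^'n) set)"
    and fix_x: "\<And>u. u \<in> unipotent_radical F \<Longrightarrow> u ** x = x"
    using singular_matrix_unipotent_radical[OF assms(3,2)] by metis
  have Z: "?Z (v + w) = ?Z v + ?Z w" "?Z (scl r v) = scl r (?Z v)"
    if "v \<in> W" "w \<in> W" for v w r
    using gauss_sum_endo that by (auto simp: linear_endo_def)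
  have Z0: "?Z 0 = 0"
    using Z(2)[of 0 0 0] subspace_0[OF subspace_W] by simp
  have "subspace {w \<in> W. ?Z w = 0}"
    using subspace_W by (auto simp: subspace_def Z Z0)
  moreover have "{\<rho> u w - w | u w. u \<in> unipotent_radical F \<and> w \<in> W} \<subseteq> {w \<in> W. ?Z w = 0}"
  proof clarify
    fix u w
    assume u: "u \<in> unipotent_radical F" and w: "w \<in> W"
    then have "u \<in> GL"
      by (simp add: unipotent_radical_def parabolic_def)
    then have uw: "\<rho> u w \<in> W" and "?Z (\<rho> u w) = ?Z w"
      using rho_closed gauss_sum_rho[of u w \<psi> x] w by (simp_all add: fix_x[OF u])
    \<comment> \<open>\<open>Z(x)\<close> is known to be additive only on \<open>W\<close>, so the
      difference has to be placed there first.\<close>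
    moreover have "\<rho> u w - w \<in> W"
      by (intro subspace_diff subspace_W uw w)
    moreover have "?Z (\<rho> u w) = ?Z (\<rho> u w - w) + ?Z w"
      using Z(1)[OF \<open>\<rho> u w - w \<in> W\<close> w] by simp
    ultimately show "\<rho> u w - w \<in> W \<and> ?Z (\<rho> u w - w) = 0"
      by simp
  qed
  ultimately show ?thesis
    using cuspidal_span[OF assms(1) F assms(4)] span_minimal by blast
qed

lemma gauss_sum_invertible:
  assumes "satisfies_schur scl W \<rho>"
  obtains \<gamma> where "\<And>x w. x \<in> GL \<Longrightarrow> w \<in> W \<Longrightarrow>
    gauss_sum scl \<rho> \<psi> x w = scl \<gamma> (\<rho> (matrix_inv x) w)"
proof -
  let ?Z = "gauss_sum scl \<rho> \<psi>"
  \<comment> \<open>The two translation laws at the inverse of \<open>g\<close> turn both sides into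
    \<open>Z\<close> of that inverse, applied to \<open>w\<close>.\<close>
  have comm: "?Z (mat 1) (\<rho> g w) = \<rho> g (?Z (mat 1) w)" if "g \<in> GL" "w \<in> W" for g w
  proof -
    have gi: "matrix_inv g \<in> GL"
      by (simp add: GL_matrix_inv that)
    have "?Z (mat 1) (\<rho> g w) = ?Z (matrix_inv g) w"
      using gauss_sum_rho[OF that, of \<psi> "matrix_inv g"] by (simp add: GL_matrix_inv that)
    moreover have "\<rho> g (?Z (mat 1) w) = ?Z (matrix_inv g) w"
      using rho_gauss_sum[OF that, of \<psi> "matrix_inv g"] by (simp add: GL_matrix_inv that)
    ultimately show ?thesis
      by simp
  qed
  \<comment> \<open>Endomorphisms are represented by extensional functions, hence the restriction to
    \<open>W\<close>.\<close>
  have "restrict (?Z (mat 1)) W \<in> GL_endos scl W \<rho>"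
  proof -
    have "linear_endo scl W (restrict (?Z (mat 1)) W)"
      using gauss_sum_endo[of \<psi> "mat 1"] subspace_add[OF subspace_W] subspace_scale[OF subspace_W]
      by (simp add: linear_endo_def Pi_iff)
    moreover have "restrict (?Z (mat 1)) W (\<rho> g w) = \<rho> g (restrict (?Z (mat 1)) W w)"
      if "g \<in> GL" "w \<in> W" for g w
      using comm[OF that] rho_closed[OF that] that(2) by simp
    ultimately show ?thesis
      by (simp add: GL_endos_def del: restrict_apply)
  qed
  moreover have "GL_endos scl W \<rho> = range (\<lambda>r. restrict (scl r) W)"
    using assms by (simp add: satisfies_schur_def bij_betw_def)
  ultimately have "restrict (?Z (mat 1)) W \<in> range (\<lambda>r. restrict (scl r) W)"
    by simp
  then obtain \<gamma> where \<gamma>: "restrict (?Z (mat 1)) W = restrict (scl \<gamma>) W"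
    by (elim rangeE)
  have scalar: "?Z (mat 1) w = scl \<gamma> w" if "w \<in> W" for w
    using fun_cong[OF \<gamma>, of w] that by simp
  show thesis
  proof (rule that)
    fix x :: "'k^'n^'n" and w
    assume x: "x \<in> GL" and w: "w \<in> W"
    have "?Z x w = \<rho> (matrix_inv x) (?Z (mat 1) w)"
      using rho_gauss_sum[OF GL_matrix_inv(3)[OF x] w, of \<psi> x] by (simp add: GL_matrix_inv x)
    then show "?Z x w = scl \<gamma> (\<rho> (matrix_inv x) w)"
      by (simp add: scalar w x rho_scale GL_matrix_inv)
  qed
qed

end

section \<open>The contragredient representation\<close>

lemma sum_fun_apply: "(\<Sum>a\<in>A. f a) x = (\<Sum>a\<in>A. f a x)"
  for f :: "'a \<Rightarrow> 'b \<Rightarrow> 'c::comm_monoid_add"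
  by (induction A rule: infinite_finite_induct) simp_all

lemma module_dual_scale: "module dual_scale"
  by unfold_locales (auto simp: dual_scale_def fun_eq_iff algebra_simps)

lemma dual_space_iff:
  assumes "module scl"
  shows "f \<in> dual_space scl \<longleftrightarrow>
    (\<forall>v w. f (v + w) = f v + f w) \<and> (\<forall>r v. f (scl r v) = r * f v)"
  using assms
  by (auto simp: dual_space_def module_hom_def module_hom_axioms_def module_def algebra_simps)

text \<open>Inversion reverses products and so does precomposition; the two reversals cancel and
  leave a left action.\<close>

lemma contragredient_representation:
  fixes \<pi> :: "'k::field^'n^'n \<Rightarrow> 'v::ab_group_add \<Rightarrow> 'v"
  assumes "GL_representation scl UNIV \<pi>"
  shows "GL_representation dual_scale (dual_space scl) (contragredient \<pi>)"
proof -
  have m: "module scl" and one: "\<pi> (mat 1) v = v" for v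
    using assms by (auto simp: GL_representation_def)
  have lin: "\<pi> g (v + w) = \<pi> g v + \<pi> g w" "\<pi> g (scl r v) = scl r (\<pi> g v)" if "g \<in> GL" for g v w r
    using assms that by (auto simp: GL_representation_def linear_endo_def)
  have mult: "\<pi> (g ** h) v = \<pi> g (\<pi> h v)" if "g \<in> GL" "h \<in> GL" for g h v
    using assms that by (auto simp: GL_representation_def)
  have "matrix_inv (mat 1 :: 'k^'n^'n) = mat 1"
    by (intro matrix_inv_unique mat_1_GL) simp
  moreover have "module.subspace dual_scale (dual_space scl)"
    by (auto simp: module.subspace_def[OF module_dual_scale] dual_space_iff[OF m] dual_scale_def
        algebra_simps)
  moreover have "linear_endo dual_scale (dual_space scl) (contragredient \<pi> g)" if "g \<in> GL" for g
    using GL_matrix_inv(3)[OF that]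
    by (auto simp: linear_endo_def dual_space_iff[OF m] contragredient_def dual_scale_def lin)
  ultimately show ?thesis
    by (simp add: GL_representation_def module_dual_scale contragredient_def one matrix_inv_mult
        mult GL_matrix_inv)
qed

theorem proposition3p6:
  fixes \<iota> :: "complex \<Rightarrow> 'r::comm_ring_1"
    and s :: 'r
    and scl :: "'r \<Rightarrow> 'v::ab_group_add \<Rightarrow> 'v"
    and \<pi> :: "'k::{field,finite}^'n^'n \<Rightarrow> 'v \<Rightarrow> 'v"
  assumes "cyclotomic_algebra CHAR('k) \<iota>"
    and "inj_on \<iota> (root_group CHAR('k))"
    and "s dvd 1"
    and "s ^ 2 = of_nat (CARD('k^'n^'n))"
    and "CARD('n) \<ge> 2"
    and "GL_representation scl UNIV \<pi>"
    and "cuspidal dual_scale (dual_space scl) (contragredient \<pi>)"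
    and "satisfies_schur dual_scale (dual_space scl) (contragredient \<pi>)"
  shows "\<forall>\<psi> :: 'k \<Rightarrow> 'r. spectral_character \<iota> \<psi> \<and> (\<exists>x. \<psi> x \<noteq> 1) \<longrightarrow>
    (\<exists>\<gamma> :: 'r. \<forall>\<Phi> :: 'k^'n^'n \<Rightarrow> 'r. \<forall>v. \<forall>v' \<in> dual_space scl.
       (\<Sum>g\<in>GL. matrix_fourier s \<psi> \<Phi> g * v' (\<pi> (matrix_inv g) v)) =
       \<gamma> * (\<Sum>g\<in>GL. \<Phi> g * v' (\<pi> g v)))"
proof (intro allI impI)
  fix \<psi> :: "'k \<Rightarrow> 'r"
  interpret GL_rep dual_scale "dual_space scl" "contragredient \<pi>"
    by unfold_locales (rule contragredient_representation[OF assms(6)])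
  let ?Z = "gauss_sum dual_scale (contragredient \<pi>) \<psi>"
  \<comment> \<open>The Schur scalar is fixed before \<open>\<Phi>\<close>, \<open>v\<close> and
    \<open>f\<close>, so it is uniform in them.\<close>
  obtain \<gamma> where \<gamma>: "\<And>x f. x \<in> GL \<Longrightarrow> f \<in> dual_space scl \<Longrightarrow>
      ?Z x f = dual_scale \<gamma> (contragredient \<pi> (matrix_inv x) f)"
    using gauss_sum_invertible[OF assms(8)] by metis
  have Z: "?Z x f v = (\<Sum>g\<in>GL. \<psi> (trace (x ** g)) * f (\<pi> (matrix_inv g) v))" for x f v
    by (simp add: gauss_sum_def sum_fun_apply dual_scale_def contragredient_def)
  show "\<exists>\<gamma>. \<forall>\<Phi> v. \<forall>f\<in>dual_space scl.
      (\<Sum>g\<in>GL. matrix_fourier s \<psi> \<Phi> g * f (\<pi> (matrix_inv g) v)) = \<gamma> * (\<Sum>g\<in>GL. \<Phi> g * f (\<pi> g v))"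
  proof (intro exI allI ballI)
    fix \<Phi> :: "'k^'n^'n \<Rightarrow> 'r" and v f
    assume f: "f \<in> dual_space scl"
    have "(\<Sum>g\<in>GL. matrix_fourier s \<psi> \<Phi> g * f (\<pi> (matrix_inv g) v)) =
        unit_inverse s * (\<Sum>g\<in>GL. \<Sum>x\<in>UNIV. \<Phi> x * (\<psi> (trace (x ** g)) * f (\<pi> (matrix_inv g) v)))"
      by (simp add: matrix_fourier_def sum_distrib_left sum_distrib_right mult.assoc)
    \<comment> \<open>Exchanging the sums collects the coefficient of each \<open>\<Phi> x\<close>
      into a Gauss sum at \<open>x\<close>.\<close>
    also have "\<dots> = unit_inverse s * (\<Sum>x\<in>UNIV. \<Phi> x * ?Z x f v)"
      by (subst sum.swap) (simp add: Z sum_distrib_left)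
    also have "(\<Sum>x\<in>UNIV. \<Phi> x * ?Z x f v) = (\<Sum>x\<in>GL. \<Phi> x * ?Z x f v)"
      by (rule sum.mono_neutral_right) (auto simp: gauss_sum_singular[OF assms(7,5) _ f])
    \<comment> \<open>The inverse from the Gauss sum and the one in the contragredient cancel,
      leaving \<open>\<pi> x\<close>.\<close>
    also have "\<dots> = (\<Sum>x\<in>GL. \<gamma> * (\<Phi> x * f (\<pi> x v)))"
      by (intro sum.cong)
        (simp_all add: \<gamma> f dual_scale_def contragredient_def matrix_inv_involution mult.left_commute)
    \<comment> \<open>The witness left open by \<open>exI\<close> becomes
      \<open>unit_inverse s * \<gamma>\<close>: the Schur scalar times the Fourier
      normalization.\<close>
    finally show "(\<Sum>g\<in>GL. matrix_fourier s \<psi> \<Phi> g * f (\<pi> (matrix_inv g) v)) =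
        unit_inverse s * \<gamma> * (\<Sum>g\<in>GL. \<Phi> g * f (\<pi> g v))"
      by (simp add: sum_distrib_left mult.assoc)
  qed
qed

end
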